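(* Let $G$ be a graph with minimum degree at least $2$ and at least two cycles, and let $B$ be its NB-matrix. Suppose $\mathbf v\neq 0$ and $B\mathbf{v}=\lambda\mathbf{v}$ with $\lambda\neq0$. Then $\mathbf{v}$ is non-leaky if and only if $\lambda$ is a root of unity.
   Context: Graphs are finite, simple, undirected, unweighted, connected. Let $\bar E$ be the set of oriented edges of $G$ (two for each undirected edge). The NB-matrix $B$ is indexed by $\bar E$ with $B_{k\to l,\,i\to j}=\delta_{jk}(1-\delta_{il})$. Vectors are complex vectors indexed by $\bar E$. Write $d_k$ for the degree of node $k$, $(a_{ij})$ for the adjacency matrix, and $\vec{\mathbf v}^{\,k}:=\sum_i a_{ik}\mathbf v_{i\to k}$ (sum of $\mathbf v$ over oriented edges into $k$). The support of a vector $\mathbf v$ is viewed as the set $\mathcal D$ of nodes incident to oriented edges on which $\mathbf v$ is nonzero. $\mathbf v$ is leaky if there is $k\in\mathcal D$ with $(d_k-2)\,\vec{\mathbf v}^{\,k}\neq 0$; otherwise $\mathbf v$ is non-leaky. *)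

theory Defs
  imports Complex_Main "Graph_Theory.Graph_Theory"
begin

text \<open>
  A finite simple undirected graph is a value \<open>G :: 'a pair_pre_digraph\<close> satisfying
  \<^locale>\<open>pair_graph\<close>: its arc set \<open>parcs G\<close> is finite, symmetric and loop-free and contains the
  pairs \<open>(i, j)\<close> and \<open>(j, i)\<close> for every undirected edge \<open>ij\<close>. So \<open>parcs G\<close> is exactly the set of
  oriented edges, with \<open>(i, j)\<close> standing for \<open>i \<rightarrow> j\<close>. Vectors indexed by oriented edges are
  functions \<open>'a \<times> 'a \<Rightarrow> complex\<close> of which only the values on \<open>parcs G\<close> are ever used.
\<close>

text \<open>
  The library notion of a cycle also covers the closed walk \<open>i \<rightarrow> j \<rightarrow> i\<close> along a single undirected
  edge; in a simple graph this is excluded by requiring length at least 3. Passing to the set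
  of undirected edges identifies cycles differing only in base point or direction.
\<close>

definition cycles :: "'a pair_pre_digraph \<Rightarrow> 'a set set set" where
  "cycles G = {(\<lambda>(i, j). {i, j}) ` set p | p. pre_digraph.cycle (with_proj G) p \<and> length p \<ge> 3}"

abbreviation deg :: "'a pair_pre_digraph \<Rightarrow> 'a \<Rightarrow> nat" where
  "deg G k \<equiv> out_degree (with_proj G) k"

definition adjacency :: "'a pair_pre_digraph \<Rightarrow> 'a \<Rightarrow> 'a \<Rightarrow> complex" where
  "adjacency G i j = of_bool ((i, j) \<in> parcs G)"

text \<open>The row index is \<open>k \<rightarrow> l\<close>, the column index is \<open>i \<rightarrow> j\<close>.\<close>

fun nb_matrix :: "'a \<times> 'a \<Rightarrow> 'a \<times> 'a \<Rightarrow> complex" where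
  "nb_matrix (k, l) (i, j) = of_bool (j = k) * (1 - of_bool (i = l))"

definition nb_mult :: "'a pair_pre_digraph \<Rightarrow> ('a \<times> 'a \<Rightarrow> complex) \<Rightarrow> 'a \<times> 'a \<Rightarrow> complex" where
  "nb_mult G v e = (\<Sum>f\<in>parcs G. nb_matrix e f * v f)"

definition inflow :: "'a pair_pre_digraph \<Rightarrow> ('a \<times> 'a \<Rightarrow> complex) \<Rightarrow> 'a \<Rightarrow> complex" where
  "inflow G v k = (\<Sum>i\<in>pverts G. adjacency G i k * v (i, k))"

definition support_nodes :: "'a pair_pre_digraph \<Rightarrow> ('a \<times> 'a \<Rightarrow> complex) \<Rightarrow> 'a set" where
  "support_nodes G v = (\<Union>(i, j)\<in>{e \<in> parcs G. v e \<noteq> 0}. {i, j})"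

definition leaky :: "'a pair_pre_digraph \<Rightarrow> ('a \<times> 'a \<Rightarrow> complex) \<Rightarrow> bool" where
  "leaky G v \<longleftrightarrow> (\<exists>k\<in>support_nodes G v. (of_nat (deg G k) - 2) * inflow G v k \<noteq> 0)"

end

theory Submission
  imports Defs
begin

text \<open>
  Let \<open>s\<^sub>k\<close> be the inflow of \<open>v\<close> at the node \<open>k\<close>, and \<open>d\<^sub>k\<close> the degree. The non-backtracking matrix
  subtracts from the inflow the one summand that would turn back, so
  \<open>(Bv)(k \<rightarrow> l) = s\<^sub>k - v(l \<rightarrow> k)\<close> (lemma \<open>nb_mult_arc\<close>). Since the inflow vanishes outside the
  support, being non-leaky means \<open>(d\<^sub>k - 2) s\<^sub>k = 0\<close> at every node (lemma \<open>not_leaky_iff\<close>).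

  If \<open>v\<close> is non-leaky, then \<open>B\<close> acts on \<open>v\<close> as a signed permutation: at a node with \<open>s\<^sub>k = 0\<close> it
  reverses arcs and changes the sign, and at a node of degree 2 it just passes the value of the
  incoming arc on to the outgoing one. Hence multiplication by the eigenvalue maps the finite set of
  values \<open>\<plusminus>v(e)\<close> into itself (lemma \<open>nonleaky_shift\<close>), and a scalar that does so with a
  nonzero element in the set is a root of unity (lemma \<open>root_of_unity_if_finite_invariant\<close>).

  Conversely, expanding \<open>\<bar>s\<^sub>k - v(l \<rightarrow> k)\<bar>\<^sup>2\<close> and summing over all arcs gives the energy balance
  \<open>\<parallel>Bv\<parallel>\<^sup>2 = \<parallel>v\<parallel>\<^sup>2 + (\<Sum>k. (d\<^sub>k - 2) \<bar>s\<^sub>k\<bar>\<^sup>2)\<close> (lemma \<open>nb_mult_energy\<close>). An eigenvalue on the unit circle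
  forces the last sum to vanish. All degrees being at least 2, its terms are nonnegative, so each
  of them is zero, and \<open>v\<close> is non-leaky.
\<close>

lemma root_of_unity_if_finite_invariant:
  fixes lam z :: "'b::field"
  assumes "finite Z" and z: "z \<in> Z" "z \<noteq> 0" and inv: "\<And>y. y \<in> Z \<Longrightarrow> lam * y \<in> Z"
    and "lam \<noteq> 0"
  shows "\<exists>n::nat. n > 0 \<and> lam ^ n = 1"
proof -
  have orbit: "lam ^ n * z \<in> Z" for n
    by (induction n) (use z inv in \<open>auto simp: mult.assoc\<close>)
  then have "range (\<lambda>n. lam ^ n * z) \<subseteq> Z"
    by blast
  then have "\<not> inj (\<lambda>n. lam ^ n * z)"
    using \<open>finite Z\<close> finite_subset finite_imageD infinite_UNIV_nat by blast
  then obtain m n where mn: "m < n" "lam ^ m = lam ^ n"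
    using z by (metis (no_types, lifting) injI mult_right_cancel nat_neq_iff)
  have "lam ^ m * lam ^ (n - m) = lam ^ m * 1"
    by (metis add_diff_inverse_nat less_imp_not_less mn mult.right_neutral power_add)
  then have "lam ^ (n - m) = 1"
    using \<open>lam \<noteq> 0\<close> by simp
  then show ?thesis
    using mn by (intro exI[of _ "n - m"]) simp
qed

text \<open>
  The matrix of all ones minus the identity, applied to \<open>x\<close>: the cross terms of the expanded square
  sum to \<open>-2 \<bar>s\<bar>\<^sup>2\<close>, because the entries of \<open>x\<close> sum to \<open>s\<close>.
\<close>

lemma sum_norm_total_minus_entry:
  fixes x :: "'b \<Rightarrow> complex"
  assumes "finite A"
  defines "s \<equiv> sum x A"
  shows "(\<Sum>l\<in>A. (cmod (s - x l))\<^sup>2) = (\<Sum>l\<in>A. (cmod (x l))\<^sup>2) + (real (card A) - 2) * (cmod s)\<^sup>2"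
proof -
  have expand: "(cmod (s - y))\<^sup>2 = (cmod s)\<^sup>2 + (cmod y)\<^sup>2 - 2 * (Re s * Re y + Im s * Im y)" for y
    by (simp add: cmod_power2 power2_diff)
  have cross: "(\<Sum>l\<in>A. Re s * Re (x l) + Im s * Im (x l)) = (cmod s)\<^sup>2"
    unfolding cmod_power2
    by (simp add: s_def power2_eq_square sum.distrib flip: sum_distrib_left)
  have "(\<Sum>l\<in>A. (cmod (s - x l))\<^sup>2) = (\<Sum>l\<in>A. (cmod s)\<^sup>2) + (\<Sum>l\<in>A. (cmod (x l))\<^sup>2)
      - 2 * (\<Sum>l\<in>A. Re s * Re (x l) + Im s * Im (x l))"
    unfolding expand sum_subtractf sum_distrib_left by (simp only: sum.distrib)
  then show ?thesis
    unfolding cross by (simp add: algebra_simps)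
qed

context pair_graph
begin

definition neighbours :: "'a \<Rightarrow> 'a set" where
  "neighbours k = {l. (k, l) \<in> parcs G}"

lemma finite_neighbours: "finite (neighbours k)"
  by (rule finite_subset[OF _ finite_imageI[OF finite_arcs, of snd]])
    (force simp: neighbours_def image_iff)

lemma arc_commute: "(k, l) \<in> parcs G \<longleftrightarrow> (l, k) \<in> parcs G"
  using arcs_symmetric by blast

lemma deg_eq_card_neighbours: "deg G k = card (neighbours k)"
proof -
  have "out_arcs (with_proj G) k = Pair k ` neighbours k"
    by (auto simp: out_arcs_def neighbours_def)
  then show ?thesis
    by (simp add: out_degree_def card_image inj_on_def)
qed

lemma inflow_eq_sum_neighbours: "inflow G v k = (\<Sum>i\<in>neighbours k. v (i, k))"
proof -
  have "inflow G v k = (\<Sum>i\<in>pverts G. if (i, k) \<in> parcs G then v (i, k) else 0)"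
    unfolding inflow_def adjacency_def by (rule sum.cong) auto
  also have "\<dots> = (\<Sum>i\<in>{i \<in> pverts G. (i, k) \<in> parcs G}. v (i, k))"
    by (simp add: sum.inter_filter)
  also have "{i \<in> pverts G. (i, k) \<in> parcs G} = neighbours k"
    using arc_commute by (auto simp: neighbours_def dest: in_arcsD1)
  finally show ?thesis .
qed

lemma sum_arcs: "(\<Sum>e\<in>parcs G. f e) = (\<Sum>k\<in>pverts G. \<Sum>l\<in>neighbours k. f (k, l))"
proof -
  have "parcs G = (SIGMA k:pverts G. neighbours k)"
    by (auto simp: neighbours_def dest: in_arcsD1)
  then show ?thesis
    by (simp add: sum.Sigma finite_neighbours)
qed

lemma sum_arcs_reversed:
  "(\<Sum>e\<in>parcs G. f e) = (\<Sum>k\<in>pverts G. \<Sum>l\<in>neighbours k. f (l, k))"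
proof -
  have "(\<Sum>e\<in>parcs G. f e) = (\<Sum>e\<in>parcs G. f (prod.swap e))"
    by (rule sum.reindex_bij_witness[of _ prod.swap prod.swap]) (auto simp: arc_commute)
  then show ?thesis
    by (simp add: sum_arcs)
qed

lemma nb_mult_arc:
  assumes "(k, l) \<in> parcs G"
  shows "nb_mult G v (k, l) = inflow G v k - v (l, k)"
proof -
  have "nb_mult G v (k, l) =
      (\<Sum>j\<in>pverts G. \<Sum>i\<in>neighbours j. nb_matrix (k, l) (i, j) * v (i, j))"
    by (simp only: nb_mult_def sum_arcs_reversed)
  also have "\<dots> = (\<Sum>j\<in>pverts G. if j = k then \<Sum>i\<in>neighbours k. (1 - of_bool (i = l)) * v (i, k) else 0)"
    by (rule sum.cong) auto
  also have "\<dots> = (\<Sum>i\<in>neighbours k. (1 - of_bool (i = l)) * v (i, k))"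
    using in_arcsD1[OF assms] by simp
  also have "\<dots> = (\<Sum>i\<in>neighbours k. v (i, k) - (if i = l then v (l, k) else 0))"
    by (rule sum.cong) auto
  also have "\<dots> = inflow G v k - (if l \<in> neighbours k then v (l, k) else 0)"
    by (simp add: sum_subtractf finite_neighbours inflow_eq_sum_neighbours)
  also have "\<dots> = inflow G v k - v (l, k)"
    using assms by (simp add: neighbours_def)
  finally show ?thesis .
qed

lemma nb_mult_energy:
  "(\<Sum>e\<in>parcs G. (cmod (nb_mult G v e))\<^sup>2) =
    (\<Sum>e\<in>parcs G. (cmod (v e))\<^sup>2) +
    (\<Sum>k\<in>pverts G. (real (deg G k) - 2) * (cmod (inflow G v k))\<^sup>2)"
proof -
  have "(\<Sum>e\<in>parcs G. (cmod (nb_mult G v e))\<^sup>2) =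
      (\<Sum>k\<in>pverts G. \<Sum>l\<in>neighbours k. (cmod (inflow G v k - v (l, k)))\<^sup>2)"
    unfolding sum_arcs by (intro sum.cong refl) (simp add: nb_mult_arc neighbours_def)
  also have "\<dots> = (\<Sum>k\<in>pverts G. (\<Sum>l\<in>neighbours k. (cmod (v (l, k)))\<^sup>2) +
      (real (deg G k) - 2) * (cmod (inflow G v k))\<^sup>2)"
    unfolding inflow_eq_sum_neighbours deg_eq_card_neighbours
    by (intro sum.cong refl sum_norm_total_minus_entry finite_neighbours)
  finally show ?thesis
    by (simp add: sum.distrib sum_arcs_reversed)
qed

lemma not_leaky_iff:
  "\<not> leaky G v \<longleftrightarrow> (\<forall>k\<in>pverts G. deg G k = 2 \<or> inflow G v k = 0)"
proof -
  have outside: "inflow G v k = 0" if "k \<notin> support_nodes G v" for k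
    using that arc_commute unfolding inflow_eq_sum_neighbours
    by (intro sum.neutral) (fastforce simp: support_nodes_def neighbours_def)
  have "support_nodes G v \<subseteq> pverts G"
    by (auto simp: support_nodes_def dest: in_arcsD1 in_arcsD2)
  moreover have "(of_nat (deg G k) - 2 :: complex) = 0 \<longleftrightarrow> deg G k = 2" for k
    by (metis eq_iff_diff_eq_0 of_nat_eq_iff of_nat_numeral)
  ultimately show ?thesis
    using outside unfolding leaky_def by (metis mult_eq_0_iff subsetD)
qed

text \<open>
  Either the inflow at \<open>k\<close> vanishes, which leaves only the reversed arc, or \<open>k\<close> has exactly one other
  neighbour besides \<open>l\<close>, whose arc into \<open>k\<close> is all that remains of the inflow.
\<close>

lemma nonleaky_shift:
  assumes "\<not> leaky G v" and arc: "(k, l) \<in> parcs G"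
  obtains f where "f \<in> parcs G" "nb_mult G v (k, l) = v f \<or> nb_mult G v (k, l) = - v f"
proof (cases "inflow G v k = 0")
  case True
  then show thesis
    using that[of "(l, k)"] arc arc_commute by (simp add: nb_mult_arc)
next
  case False
  then have "card (neighbours k) = 2"
    using assms in_arcsD1[OF arc] by (auto simp: not_leaky_iff deg_eq_card_neighbours)
  moreover have "l \<in> neighbours k"
    using arc by (simp add: neighbours_def)
  ultimately obtain m where m: "neighbours k = {l, m}" "l \<noteq> m"
    by (metis card_2_iff' card_2_iff doubleton_eq_iff insert_iff singletonD)
  then have "(m, k) \<in> parcs G"
    using arc_commute by (auto simp: neighbours_def)
  moreover have "nb_mult G v (k, l) = v (m, k)"
    using m by (simp add: nb_mult_arc[OF arc] inflow_eq_sum_neighbours)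
  ultimately show thesis
    using that by blast
qed

lemma root_of_unity_if_nonleaky:
  assumes "\<not> leaky G v" and e: "e \<in> parcs G" "v e \<noteq> 0"
    and eig: "\<forall>e\<in>parcs G. nb_mult G v e = lam * v e" and "lam \<noteq> 0"
  shows "\<exists>n::nat. n > 0 \<and> lam ^ n = 1"
proof -
  have step: "\<exists>f\<in>parcs G. lam * v g = v f \<or> lam * v g = - v f" if "g \<in> parcs G" for g
    using that eig nonleaky_shift[OF \<open>\<not> leaky G v\<close>] by (metis surj_pair)
  let ?Z = "v ` parcs G \<union> (\<lambda>f. - v f) ` parcs G"
  show ?thesis
  proof (rule root_of_unity_if_finite_invariant[of ?Z "v e"])
    show "lam * y \<in> ?Z" if "y \<in> ?Z" for y
      using that step by (fastforce simp: image_iff)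
  qed (use e \<open>lam \<noteq> 0\<close> in auto)
qed

lemma nonleaky_if_unimodular:
  assumes deg: "\<forall>k\<in>pverts G. deg G k \<ge> 2"
    and eig: "\<forall>e\<in>parcs G. nb_mult G v e = lam * v e" and "cmod lam = 1"
  shows "\<not> leaky G v"
proof -
  have "(\<Sum>e\<in>parcs G. (cmod (nb_mult G v e))\<^sup>2) = (\<Sum>e\<in>parcs G. (cmod (v e))\<^sup>2)"
    using eig \<open>cmod lam = 1\<close> by (simp add: norm_mult)
  then have "(\<Sum>k\<in>pverts G. (real (deg G k) - 2) * (cmod (inflow G v k))\<^sup>2) = 0"
    using nb_mult_energy[of v] by simp
  then have "\<forall>k\<in>pverts G. (real (deg G k) - 2) * (cmod (inflow G v k))\<^sup>2 = 0"
    using deg by (subst (asm) sum_nonneg_eq_0_iff) auto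
  then show ?thesis
    by (auto simp: not_leaky_iff)
qed

end

theorem theorem4p5:
  fixes G :: "'a pair_pre_digraph"
    and v :: "'a \<times> 'a \<Rightarrow> complex"
    and lam :: complex
  assumes "pair_graph G"
    and "Digraph_Component.connected (with_proj G)"
    and "\<forall>k\<in>pverts G. deg G k \<ge> 2"
    and "card (cycles G) \<ge> 2"
    and "\<exists>e\<in>parcs G. v e \<noteq> 0"
    and "\<forall>e\<in>parcs G. nb_mult G v e = lam * v e"
    and "lam \<noteq> 0"
  shows "\<not> leaky G v \<longleftrightarrow> (\<exists>n::nat. n > 0 \<and> lam ^ n = 1)"
proof -
  interpret pair_graph G by fact
  show ?thesis
  proof
    assume "\<not> leaky G v"
    then show "\<exists>n::nat. n > 0 \<and> lam ^ n = 1"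
      using assms(5-7) root_of_unity_if_nonleaky by blast
  next
    assume "\<exists>n::nat. n > 0 \<and> lam ^ n = 1"
    then have "cmod lam = 1"
      using power_eq_imp_eq_norm[of lam _ 1] by auto
    then show "\<not> leaky G v"
      using nonleaky_if_unimodular assms(3,6) by blast
  qed
qed

end
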